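(* Let $L\ge2$ be an integer and $R\ge0$. For any discrete memoryless channel $W_{\mathbf{y}|\mathbf{x}}$ with input alphabet $\mathcal{X}$ and output alphabet $\mathcal{Y}$, there exists a sequence of codes $\mathcal{C}_n\subset\mathcal{X}^n$ of increasing blocklengths $n$, each of rate at least $R$, satisfying $$\liminf_{n\to\infty}-\frac1n\log P_{\mathrm{e},\mathrm{avg},L-1}(\mathcal{C}_n)\ge E_{\mathrm{r},L-1}(R),$$ where $$E_{\mathrm{r},L-1}(R)=\max_{P_{\mathbf{x}}\in\Delta(\mathcal{X})}\ \max_{0\le\rho\le1}\left\{-(L-1)\rho R+E_0((L-1)\rho,P_{\mathbf{x}})\right\},$$ $$E_0(\rho,P_{\mathbf{x}})=-\log\left[\sum_{y\in\mathcal{Y}}\left(\sum_{x\in\mathcal{X}}P_{\mathbf{x}}(x)\,W_{\mathbf{y}|\mathbf{x}}(y|x)^{\frac1{1+\rho}}\right)^{1+\rho}\right].$$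
   Context: $\log$ is to base $2$; $\Delta(\mathcal{X})$ is the set of probability distributions on $\mathcal{X}$. A discrete memoryless channel (DMC) is given by discrete alphabets $\mathcal{X},\mathcal{Y}$ and conditional probabilities $W_{\mathbf{y}|\mathbf{x}}(y|x)$; input $x\in\mathcal{X}^n$ produces output $y\in\mathcal{Y}^n$ with probability $\prod_{j=1}^nW_{\mathbf{y}|\mathbf{x}}(y(j)|x(j))$. A code of blocklength $n$ is a codebook $\mathcal{C}=\{x_i\}_{i=1}^M$ of $M$ indexed codewords in $\mathcal{X}^n$ (repetitions allowed), of rate $\frac1n\log M$, equipped with an $(L-1)$-list-decoder assigning to each $y\in\mathcal{Y}^n$ a set of $L-1$ indices in $\{1,\dots,M\}$. $P_{\mathrm{e},L-1}(i,\mathcal{C})$ is the probability that, when $x_i$ is sent, the decoder's output list does not contain $i$, and $P_{\mathrm{e},\mathrm{avg},L-1}(\mathcal{C})=\frac1M\sum_{i=1}^MP_{\mathrm{e},L-1}(i,\mathcal{C})$. *)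

theory Defs
  imports "HOL-Probability.Probability"
begin

text \<open>
  A channel is a stochastic kernel \<open>W :: 'x \<Rightarrow> 'y pmf\<close>, with \<open>W(y|x) = pmf (W x) y\<close>.
  A word of length \<open>n\<close> over an alphabet is an element of \<open>{1..n} \<rightarrow>\<^sub>E UNIV\<close>.
\<close>

definition words :: "nat \<Rightarrow> (nat \<Rightarrow> 'a) set" where
  "words n = {1..n} \<rightarrow>\<^sub>E UNIV"

definition channel_output :: "('x \<Rightarrow> 'y pmf) \<Rightarrow> nat \<Rightarrow> (nat \<Rightarrow> 'x) \<Rightarrow> (nat \<Rightarrow> 'y) pmf" where
  "channel_output W n x = Pi_pmf {1..n} undefined (\<lambda>j. W (x j))"

lemma pmf_channel_output:
  assumes "y \<in> words n"
  shows "pmf (channel_output W n x) y = (\<Prod>j = 1..n. pmf (W (x j)) (y j))"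
  unfolding channel_output_def
  by (rule pmf_Pi') (use assms in \<open>auto simp: words_def PiE_def extensional_def\<close>)

lemma set_pmf_channel_output: "set_pmf (channel_output W n x) \<subseteq> words n"
  by (auto simp: channel_output_def words_def PiE_def extensional_def
      dest!: subsetD[OF set_Pi_pmf_subset'[OF finite_atLeastAtMost]] split: if_splits)
    (auto simp: PiE_dflt_def)

record ('x, 'y) list_code =
  code_size :: nat
  codeword :: "nat \<Rightarrow> nat \<Rightarrow> 'x"
  decoder :: "(nat \<Rightarrow> 'y) \<Rightarrow> nat set"

text \<open>
  Repeated codewords are allowed, so \<open>codeword\<close> need not be injective.
\<close>

definition is_list_code :: "nat \<Rightarrow> nat \<Rightarrow> ('x, 'y) list_code \<Rightarrow> bool" where
  "is_list_code n l c \<longleftrightarrow>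
     code_size c \<ge> 1 \<and>
     (\<forall>i\<in>{1..code_size c}. codeword c i \<in> words n) \<and>
     (\<forall>y\<in>words n. decoder c y \<subseteq> {1..code_size c} \<and> card (decoder c y) = l)"

definition code_rate :: "nat \<Rightarrow> ('x, 'y) list_code \<Rightarrow> real" where
  "code_rate n c = log 2 (real (code_size c)) / real n"

definition err_prob :: "('x \<Rightarrow> 'y pmf) \<Rightarrow> nat \<Rightarrow> ('x, 'y) list_code \<Rightarrow> nat \<Rightarrow> real" where
  "err_prob W n c i =
     measure_pmf.prob (channel_output W n (codeword c i)) {y \<in> words n. i \<notin> decoder c y}"

definition avg_err_prob :: "('x \<Rightarrow> 'y pmf) \<Rightarrow> nat \<Rightarrow> ('x, 'y) list_code \<Rightarrow> real" where
  "avg_err_prob W n c = (\<Sum>i = 1..code_size c. err_prob W n c i) / real (code_size c)"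

text \<open>
  The value of \<open>-(1/n) log p\<close> for a probability \<open>p\<close>, with the convention \<open>-log 0 = \<infinity>\<close>
  (whereas \<open>log 2 0 = 0\<close> in HOL).
\<close>

definition exponent :: "nat \<Rightarrow> real \<Rightarrow> ereal" where
  "exponent n p = (if p = 0 then \<infinity> else ereal (- (1 / real n) * log 2 p))"

definition E0 :: "('x \<Rightarrow> 'y pmf) \<Rightarrow> real \<Rightarrow> 'x pmf \<Rightarrow> real" where
  "E0 W \<rho> P = - log 2 (\<Sum>\<^sub>\<infinity>y\<in>UNIV.
     (\<Sum>\<^sub>\<infinity>x\<in>UNIV. pmf P x * pmf (W x) y powr (1 / (1 + \<rho>))) powr (1 + \<rho>))"

text \<open>
  The maximum over \<open>P\<close> and \<open>\<rho>\<close>, taken as a supremum in the extended reals so that countably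
  infinite alphabets are covered. For finite alphabets the supremum is attained; see
  \<open>random_coding_exponent_attained\<close> below.
\<close>

definition random_coding_exponent :: "('x \<Rightarrow> 'y pmf) \<Rightarrow> nat \<Rightarrow> real \<Rightarrow> ereal" where
  "random_coding_exponent W l R =
     (SUP P\<in>UNIV. SUP \<rho>\<in>{0..1}. ereal (- real l * \<rho> * R + E0 W (real l * \<rho>) P))"

text \<open>Both series in \<open>E0\<close> converge, and the argument of the logarithm lies in \<open>{0<..1}\<close>.\<close>

lemma E0_inner_summable:
  fixes W :: "'x \<Rightarrow> 'y pmf"
  assumes "s \<ge> 0"
  shows "(\<lambda>x. pmf P x * pmf (W x) y powr s) summable_on UNIV"
proof (rule summable_on_comparison_test)
  show "pmf P summable_on UNIV"
    using pmf_abs_summable[of P UNIV] abs_summable_equivalent summable_on_iff_abs_summable_on_real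
    by blast
  show "pmf P x * pmf (W x) y powr s \<le> pmf P x" for x
    by (rule mult_left_le) (use assms in \<open>auto intro: powr_le1 simp: pmf_le_1\<close>)
qed auto

lemma pmf_has_sum: "(pmf p has_sum 1) UNIV"
proof -
  have "pmf p summable_on UNIV"
    using pmf_abs_summable[of p UNIV] abs_summable_equivalent summable_on_iff_abs_summable_on_real
    by blast
  moreover have "infsum (pmf p) UNIV = 1"
    using infsetsum_infsum[OF pmf_abs_summable[of p UNIV]] infsetsum_pmf_eq_1[of p UNIV] by simp
  ultimately show ?thesis by (metis has_sum_infsum)
qed

lemma E0_inner_le:
  fixes W :: "'x \<Rightarrow> 'y pmf"
  assumes "\<rho> \<ge> 0"
  shows "(\<Sum>\<^sub>\<infinity>x\<in>UNIV. pmf P x * pmf (W x) y powr (1 / (1 + \<rho>))) powr (1 + \<rho>)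
           \<le> (\<Sum>\<^sub>\<infinity>x\<in>UNIV. pmf P x * pmf (W x) y)"
proof -
  define s where "s = 1 / (1 + \<rho>)"
  have s: "0 < s" "s \<le> 1" "s * (1 + \<rho>) = 1" using assms by (auto simp: s_def field_simps)
  let ?A = "\<Sum>\<^sub>\<infinity>x\<in>UNIV. pmf P x * pmf (W x) y"
  have sm1: "(\<lambda>x. pmf P x * pmf (W x) y) summable_on UNIV"
    using E0_inner_summable[of 1 P W y] by simp
  have sms: "(\<lambda>x. pmf P x * pmf (W x) y powr s) summable_on UNIV"
    using E0_inner_summable[of s P W y] s by simp
  have hsA: "((\<lambda>x. pmf P x * pmf (W x) y) has_sum ?A) UNIV"
    using sm1 by (rule has_sum_infsum)
  have "?A \<ge> 0" by (rule infsum_nonneg) simp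
  then consider "?A = 0" | "?A > 0" by linarith
  then have "(\<Sum>\<^sub>\<infinity>x\<in>UNIV. pmf P x * pmf (W x) y powr s) \<le> ?A powr s"
  proof cases
    case 1
    have z: "pmf P x * pmf (W x) y = 0" for x
      using nonneg_infsum_le_0D[of "\<lambda>x. pmf P x * pmf (W x) y" UNIV x] 1 sm1 by auto
    have "pmf P x * pmf (W x) y powr s = 0" for x
      using z[of x] by auto
    then have "(\<Sum>\<^sub>\<infinity>x\<in>UNIV. pmf P x * pmf (W x) y powr s) = 0"
      by (intro infsum_0) blast
    then show ?thesis by simp
  next
    case 2
    have "pmf P x * pmf (W x) y powr s
            \<le> pmf P x * pmf (W x) y * (s * ?A powr (s - 1)) + pmf P x * ((1 - s) * ?A powr s)" for x
    proof -
      have "t powr s \<le> s * t + (1 - s)" if "t \<ge> 0" for t :: real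
        using Youngs_inequality_0[of s "1 - s" t 1] s that by (cases "t = 0") auto
      then have bern: "(pmf (W x) y / ?A) powr s \<le> s * (pmf (W x) y / ?A) + (1 - s)"
        using 2 by (meson divide_nonneg_pos pmf_nonneg)
      have "pmf (W x) y powr s = ?A powr s * (pmf (W x) y / ?A) powr s"
        using 2 by (simp add: powr_divide)
      also have "\<dots> \<le> ?A powr s * (s * (pmf (W x) y / ?A) + (1 - s))"
        by (intro mult_left_mono bern) simp
      also have "\<dots> = pmf (W x) y * (s * ?A powr (s - 1)) + (1 - s) * ?A powr s"
        using 2 by (simp add: powr_diff field_simps)
      finally show ?thesis
        using mult_left_mono[of _ _ "pmf P x"] by (force simp: algebra_simps)
    qed
    moreover have "((\<lambda>x. pmf P x * pmf (W x) y * (s * ?A powr (s - 1))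
                        + pmf P x * ((1 - s) * ?A powr s))
             has_sum (?A * (s * ?A powr (s - 1)) + 1 * ((1 - s) * ?A powr s))) UNIV"
      by (intro has_sum_add has_sum_cmult_left hsA pmf_has_sum)
    ultimately have "(\<Sum>\<^sub>\<infinity>x\<in>UNIV. pmf P x * pmf (W x) y powr s)
        \<le> ?A * (s * ?A powr (s - 1)) + 1 * ((1 - s) * ?A powr s)"
      using has_sum_mono[OF has_sum_infsum[OF sms]] by blast
    also have "\<dots> = ?A powr s"
      using 2 by (simp add: powr_diff field_simps)
    finally show ?thesis .
  qed
  moreover have "(\<Sum>\<^sub>\<infinity>x\<in>UNIV. pmf P x * pmf (W x) y powr s) \<ge> 0"
    by (rule infsum_nonneg) simp
  ultimately have "(\<Sum>\<^sub>\<infinity>x\<in>UNIV. pmf P x * pmf (W x) y powr s) powr (1 + \<rho>)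
                     \<le> (?A powr s) powr (1 + \<rho>)"
    using assms by (intro powr_mono2) auto
  also have "\<dots> = ?A" using s \<open>?A \<ge> 0\<close> by (simp add: powr_powr)
  finally show ?thesis by (simp add: s_def)
qed

lemma bind_pmf_infsum: "pmf (bind_pmf P W) y = (\<Sum>\<^sub>\<infinity>x\<in>UNIV. pmf P x * pmf (W x) y)"
proof -
  have "Infinite_Set_Sum.abs_summable_on (\<lambda>x. pmf P x * pmf (W x) y) UNIV"
    using E0_inner_summable[of 1 P W y]
    by (simp add: abs_summable_equivalent[symmetric] summable_on_iff_abs_summable_on_real[symmetric])
  then show ?thesis
    by (simp add: pmf_bind pmf_expectation_eq_infsetsum infsetsum_infsum)
qed

lemma E0_outer_summable:
  fixes W :: "'x \<Rightarrow> 'y pmf"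
  assumes "\<rho> \<ge> 0"
  shows "(\<lambda>y. (\<Sum>\<^sub>\<infinity>x\<in>UNIV. pmf P x * pmf (W x) y powr (1 / (1 + \<rho>))) powr (1 + \<rho>))
           summable_on UNIV"
proof (rule summable_on_comparison_test)
  show "pmf (bind_pmf P W) summable_on UNIV"
    using pmf_has_sum by (rule has_sum_imp_summable)
qed (use E0_inner_le[OF assms] in \<open>auto simp: bind_pmf_infsum\<close>)

lemma E0_argument_bounds:
  fixes W :: "'x \<Rightarrow> 'y pmf"
  assumes "\<rho> \<ge> 0"
  shows "(\<Sum>\<^sub>\<infinity>y\<in>UNIV. (\<Sum>\<^sub>\<infinity>x\<in>UNIV. pmf P x * pmf (W x) y powr (1 / (1 + \<rho>))) powr (1 + \<rho>))
           \<in> {0<..1}"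
proof -
  let ?f = "\<lambda>y x. pmf P x * pmf (W x) y powr (1 / (1 + \<rho>))"
  let ?g = "\<lambda>y. (\<Sum>\<^sub>\<infinity>x\<in>UNIV. ?f y x) powr (1 + \<rho>)"
  obtain x where x: "x \<in> set_pmf P" by (meson ex_in_conv set_pmf_not_empty)
  obtain y where y: "y \<in> set_pmf (W x)" by (meson ex_in_conv set_pmf_not_empty)
  have "infsum ?g UNIV \<noteq> 0"
  proof
    assume "infsum ?g UNIV = 0"
    then have "?g y = 0"
      using nonneg_infsum_le_0D[of ?g UNIV y] E0_outer_summable[OF assms, of P W] by auto
    then have "infsum (?f y) UNIV = 0" by simp
    then have "?f y x = 0"
      using nonneg_infsum_le_0D[of "?f y" UNIV x] E0_inner_summable[of "1 / (1 + \<rho>)" P W y] assms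
      by auto
    with x y show False by (simp add: set_pmf_iff)
  qed
  moreover have "infsum ?g UNIV \<ge> 0" by (rule infsum_nonneg) simp
  moreover have "infsum ?g UNIV \<le> 1"
    using has_sum_mono[OF has_sum_infsum[OF E0_outer_summable[OF assms, of P W]]
        pmf_has_sum[of "bind_pmf P W"]] E0_inner_le[OF assms, of P W]
    by (simp add: bind_pmf_infsum)
  ultimately show ?thesis by auto
qed

lemma random_coding_exponent_attained:
  fixes W :: "'x::finite \<Rightarrow> 'y::finite pmf"
  shows "\<exists>P. \<exists>\<rho>\<in>{0..1}.
    random_coding_exponent W l R = ereal (- real l * \<rho> * R + E0 W (real l * \<rho>) P)"
proof -
  define S :: "(real ^ 'x) set" where "S = {v. (\<forall>x. 0 \<le> v $ x) \<and> (\<Sum>x\<in>UNIV. v $ x) = 1}"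
  define A where "A = (\<lambda>z :: (real ^ 'x) \<times> real. \<Sum>y\<in>UNIV.
     (\<Sum>x\<in>UNIV. fst z $ x * pmf (W x) y powr (1 / (1 + real l * snd z))) powr (1 + real l * snd z))"
  define F where "F = (\<lambda>z :: (real ^ 'x) \<times> real. - real l * snd z * R - log 2 (A z))"
  define toP where "toP = (\<lambda>v :: real ^ 'x. embed_pmf (\<lambda>x. v $ x))"
  have pmf_toP: "pmf (toP v) x = v $ x" if "v \<in> S" for v x
    unfolding toP_def
    by (rule pmf_embed_pmf)
      (use that in \<open>auto simp: S_def nn_integral_count_space_finite\<close>)
  have ofP: "(\<chi> x. pmf P x) \<in> S" for P :: "'x pmf"
    using sum_pmf_eq_1[of UNIV P] by (auto simp: S_def)
  have A_eq: "F (v, \<rho>) = - real l * \<rho> * R + E0 W (real l * \<rho>) P"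
    if "\<And>x. pmf P x = v $ x" for v \<rho> P
    using that by (simp add: F_def A_def E0_def)
  have A_pos: "A z \<noteq> 0" if "z \<in> S \<times> {0..1}" for z
    using E0_argument_bounds[of "real l * snd z" "toP (fst z)" W] that pmf_toP[of "fst z"]
    by (auto simp: A_def)
  have "closed S"
    unfolding S_def
    by (intro closed_Collect_conj closed_Collect_all closed_Collect_le closed_Collect_eq
        continuous_intros)
  moreover have "bounded S"
  proof (rule boundedI)
    fix v assume "v \<in> S"
    then have "norm v \<le> (\<Sum>x\<in>UNIV. \<bar>v $ x\<bar>)" by (intro norm_le_l1_cart)
    also have "\<dots> = 1" using \<open>v \<in> S\<close> by (simp add: S_def)
    finally show "norm v \<le> 1" .
  qed
  ultimately have "compact (S \<times> {0..1::real})"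
    by (intro compact_Times compact_Icc) (simp add: compact_eq_bounded_closed)
  moreover have "S \<times> {0..1::real} \<noteq> {}" using ofP by fastforce
  moreover have "continuous_on (S \<times> {0..1}) F"
  proof -
    have nz: "1 + real l * snd z > 0" if "z \<in> S \<times> {0..1}" for z
      using that by (auto intro: add_pos_nonneg)
    have pc: "continuous_on (S \<times> {0..1}) (\<lambda>z. c powr (1 / (1 + real l * snd z)))"
      if "c \<ge> 0" for c :: real
      using nz that by (intro continuous_on_powr' continuous_intros ballI) fastforce+
    have "continuous_on (S \<times> {0..1}) A"
      unfolding A_def
    proof (intro continuous_on_sum continuous_on_powr' ballI conjI impI)
      fix y z
      assume "z \<in> S \<times> {0..1::real}"
      then show "(\<Sum>x\<in>UNIV. fst z $ x * pmf (W x) y powr (1 / (1 + real l * snd z))) \<ge> 0"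
        by (auto simp: S_def intro!: sum_nonneg)
    qed (use nz in \<open>auto intro!: continuous_intros pc\<close>)
    moreover have "A z > 0" if "z \<in> S \<times> {0..1}" for z
      using A_pos[OF that] sum_nonneg[of UNIV] unfolding A_def
      by (smt (verit) powr_ge_zero sum_nonneg)
    ultimately show ?thesis
      unfolding F_def log_def
      by (intro continuous_intros) (auto simp: less_imp_neq[symmetric])
  qed
  ultimately obtain z where z: "z \<in> S \<times> {0..1}" "\<And>w. w \<in> S \<times> {0..1} \<Longrightarrow> F w \<le> F z"
    using continuous_attains_sup[of "S \<times> {0..1}" F] by blast
  obtain v \<rho> where v: "z = (v, \<rho>)" "v \<in> S" "\<rho> \<in> {0..1}" using z(1) by auto
  have "random_coding_exponent W l R = ereal (F z)"
    unfolding random_coding_exponent_def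
  proof (rule antisym)
    show "(SUP P. SUP \<rho>\<in>{0..1}. ereal (- real l * \<rho> * R + E0 W (real l * \<rho>) P)) \<le> ereal (F z)"
    proof (intro SUP_least)
      fix P and \<rho>' :: real assume "\<rho>' \<in> {0..1}"
      then show "ereal (- real l * \<rho>' * R + E0 W (real l * \<rho>') P) \<le> ereal (F z)"
        using z(2)[of "(\<chi> x. pmf P x, \<rho>')"] ofP[of P] A_eq[of P "\<chi> x. pmf P x" \<rho>'] by simp
    qed
    show "ereal (F z) \<le> (SUP P. SUP \<rho>\<in>{0..1}. ereal (- real l * \<rho> * R + E0 W (real l * \<rho>) P))"
      using v A_eq[of "toP v" v \<rho>] pmf_toP[of v]
      by (intro SUP_upper2[of "toP v"] SUP_upper2[of \<rho>]) auto
  qed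
  moreover have "F z = - real l * \<rho> * R + E0 W (real l * \<rho>) (toP v)"
    using v A_eq[of "toP v" v \<rho>] pmf_toP[of v] by simp
  ultimately show ?thesis using v(3) by metis
qed

end

theory Submission
  imports Defs
begin

text \<open>
  Write \<open>l = L - 1\<close>. The proof is Gallager's random coding argument for list decoding. The
  codewords are drawn independently from an input distribution \<open>Q\<close>, and the decoder lists \<open>l\<close>
  indices of greatest likelihood. If \<open>x\<close> is sent, \<open>y\<close> is received and the list misses the sent
  index, then \<open>l\<close> other codewords are all at least as likely as \<open>x\<close>. By Markov's inequality a
  fresh codeword is that likely with probability at most \<open>q = T(y) / W(y|x)^s\<close>, where \<open>T(y)\<close> is
  the \<open>Q\<close>-average of \<open>W(y|.)^s\<close> (\<open>tilted_mass\<close>), so the union bound over the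
  \<open>l\<close>-subsets gives at most \<open>(M q)^l\<close> (\<open>prob_many_hits_le\<close>). The error probability
  given \<open>x\<close> and \<open>y\<close> is also at most 1, and a number in \<open>[0,1]\<close> is at most its \<open>\<rho>\<close>-th power
  for \<open>0 \<le> \<rho> \<le> 1\<close>; hence it is at most \<open>(M q)^(l \<rho>)\<close> (\<open>prob_confusion_le\<close>).

  With \<open>s = 1 / (1 + l \<rho>)\<close> the exponents match: averaging over \<open>x\<close> and \<open>y\<close> gives
  \<open>M^(l \<rho>)\<close> times the sum of \<open>T(y)^(1 + l \<rho>)\<close>, which is the argument of the logarithm in \<open>E0\<close>
  (\<open>random_codeword_error_le\<close>). Some codebook does at least as well as the average
  (\<open>ex_codebook_sum_error_le\<close>).

  For \<open>n\<close> uses of the channel and i.i.d. letters, \<open>T\<close> factors over the positions, so the sum is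
  at most the \<open>n\<close>-th power of its one-letter value (\<open>nn_integral_tilted_mass_product_le\<close>).
  The resulting bound \<open>(l + 2)^l 2^(-n F)\<close>, where \<open>F = -l \<rho> R + E0\<close>, has a constant that does
  not depend on the input distribution or \<open>\<rho>\<close> (\<open>ex_list_code_avg_err_le\<close>). These two
  parameters may therefore vary with \<open>n\<close>, so that \<open>F\<close> approaches a supremum that
  need not be attained and may be infinite.
\<close>

section \<open>Maximum-likelihood list decoding\<close>

text \<open>
  The argument \<open>v\<close> will be the likelihood of each index given the received word. Ties at the edge
  of the list may be broken in any way.
\<close>

definition top_list :: "nat \<Rightarrow> nat \<Rightarrow> (nat \<Rightarrow> real) \<Rightarrow> nat set" where
  "top_list l M v =
     (SOME D. D \<subseteq> {1..M} \<and> card D = l \<and> (\<forall>j\<in>D. \<forall>k\<in>{1..M} - D. v k \<le> v j))"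

lemma ex_top_subset:
  fixes v :: "'a \<Rightarrow> 'b::linorder"
  assumes "finite A" "l \<le> card A"
  shows "\<exists>D\<subseteq>A. card D = l \<and> (\<forall>j\<in>D. \<forall>k\<in>A - D. v k \<le> v j)"
  using assms(2)
proof (induction l)
  case 0
  then show ?case by (intro exI[of _ "{}"]) auto
next
  case (Suc l)
  then obtain D where D: "D \<subseteq> A" "card D = l" "\<forall>j\<in>D. \<forall>k\<in>A - D. v k \<le> v j" by auto
  have fin: "finite (v ` (A - D))" using assms(1) by simp
  have "A - D \<noteq> {}"
  proof
    assume "A - D = {}"
    then have "A = D" using D(1) by blast
    with D(2) Suc.prems show False by simp
  qed
  then have "Max (v ` (A - D)) \<in> v ` (A - D)" using fin by (intro Max_in) auto
  then obtain a where a: "a \<in> A - D" "v a = Max (v ` (A - D))" by auto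
  have "\<forall>k\<in>A - D. v k \<le> v a" using a(2) fin by simp
  moreover have "card (insert a D) = Suc l" using a D assms(1) finite_subset by fastforce
  ultimately show ?case using a D by (intro exI[of _ "insert a D"]) auto
qed

lemma top_list:
  assumes "l \<le> M"
  shows top_list_subset: "top_list l M v \<subseteq> {1..M}"
    and card_top_list: "card (top_list l M v) = l"
    and top_list_max: "\<lbrakk>j \<in> top_list l M v; k \<in> {1..M}; k \<notin> top_list l M v\<rbrakk> \<Longrightarrow> v k \<le> v j"
proof -
  have "\<exists>D. D \<subseteq> {1..M} \<and> card D = l \<and> (\<forall>j\<in>D. \<forall>k\<in>{1..M} - D. v k \<le> v j)"
    using ex_top_subset[of "{1..M}" l v] assms by auto
  from someI_ex[OF this] show "top_list l M v \<subseteq> {1..M}" "card (top_list l M v) = l"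
    "\<lbrakk>j \<in> top_list l M v; k \<in> {1..M}; k \<notin> top_list l M v\<rbrakk> \<Longrightarrow> v k \<le> v j"
    unfolding top_list_def by blast+
qed

section \<open>The probability of a decoding error given the sent and received words\<close>

text \<open>
  The union bound over the \<open>l\<close>-element sets of positions, whose entries are independent; the
  number of these sets is bounded by the \<open>l\<close>-th power of \<open>card A\<close>.
\<close>

lemma prob_many_hits_le:
  assumes "finite A"
  shows "measure_pmf.prob (Pi_pmf A d (\<lambda>_. Q)) {f. \<exists>S\<subseteq>A. card S = l \<and> f ` S \<subseteq> B}
           \<le> (real (card A) * measure_pmf.prob Q B) ^ l"
proof -
  let ?p = "Pi_pmf A d (\<lambda>_. Q)" and ?q = "measure_pmf.prob Q B"
  let ?I = "{S. S \<subseteq> A \<and> card S = l}"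
  have fin: "finite ?I" using assms by simp
  have one: "measure_pmf.prob ?p {f. f ` S \<subseteq> B} = ?q ^ l" if "S \<in> ?I" for S
  proof -
    have S: "S \<subseteq> A" "card S = l" using that by auto
    have "{f. f ` S \<subseteq> B} = Pi A (\<lambda>j. if j \<in> S then B else UNIV)"
      using S by (auto simp: Pi_def image_subset_iff)
    then have "measure_pmf.prob ?p {f. f ` S \<subseteq> B}
        = (\<Prod>j\<in>A. measure_pmf.prob Q (if j \<in> S then B else UNIV))"
      using assms by (simp add: measure_Pi_pmf_Pi)
    also have "\<dots> = (\<Prod>j\<in>A. if j \<in> S then ?q else 1)"
      by (intro prod.cong) auto
    also have "\<dots> = (\<Prod>j\<in>S. ?q)"
      using assms S by (simp add: prod.If_cases Int_absorb1)
    finally show ?thesis using S by simp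
  qed
  have "{f. \<exists>S\<subseteq>A. card S = l \<and> f ` S \<subseteq> B} = (\<Union>S\<in>?I. {f. f ` S \<subseteq> B})" by auto
  then have "measure_pmf.prob ?p {f. \<exists>S\<subseteq>A. card S = l \<and> f ` S \<subseteq> B}
      \<le> (\<Sum>S\<in>?I. measure_pmf.prob ?p {f. f ` S \<subseteq> B})"
    using fin by (simp add: measure_pmf.finite_measure_subadditive_finite)
  also have "\<dots> = real (card A choose l) * ?q ^ l"
    using assms by (simp add: one n_subsets)
  also have "\<dots> \<le> real (card A) ^ l * ?q ^ l"
  proof (intro mult_right_mono)
    show "real (card A choose l) \<le> real (card A) ^ l"
      by (cases "l \<le> card A")
        (metis binomial_le_pow of_nat_le_iff of_nat_power, simp add: binomial_eq_0)
  qed simp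
  finally show ?thesis by (simp add: power_mult_distrib)
qed

text \<open>
  For \<open>s = 1 / (1 + \<rho>)\<close> this is the inner sum of \<open>E0\<close>. As an expectation it
  factors over the positions of a word when the letters are independent.
\<close>

definition tilted_mass :: "('a \<Rightarrow> 'b pmf) \<Rightarrow> 'a pmf \<Rightarrow> real \<Rightarrow> 'b \<Rightarrow> real" where
  "tilted_mass V Q s y = measure_pmf.expectation Q (\<lambda>x. pmf (V x) y powr s)"

lemma integrable_powr_pmf:
  "s \<ge> 0 \<Longrightarrow> integrable (measure_pmf Q) (\<lambda>x. pmf (V x) y powr s)"
  by (rule measure_pmf.integrable_const_bound[where B = 1])
    (auto intro!: AE_pmfI powr_le1 simp: pmf_le_1)

lemma tilted_mass_nonneg: "0 \<le> tilted_mass V Q s y"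
  unfolding tilted_mass_def by (rule Bochner_Integration.integral_nonneg) simp

text \<open>Markov's inequality for the \<open>s\<close>-th power of the likelihood.\<close>

lemma prob_likelihood_ge_le:
  assumes "s \<ge> 0" "v > 0"
  shows "measure_pmf.prob Q {x. v \<le> pmf (V x) y} \<le> tilted_mass V Q s y / v powr s"
proof -
  have "measure_pmf.prob Q {x. v \<le> pmf (V x) y}
      \<le> measure_pmf.prob Q {x \<in> space (measure_pmf Q). v powr s \<le> pmf (V x) y powr s}"
    using assms by (intro measure_pmf.finite_measure_mono) (auto intro: powr_mono2)
  also have "\<dots> \<le> (\<integral>x. pmf (V x) y powr s \<partial>measure_pmf Q) / v powr s"
    using assms by (intro integral_Markov_inequality_measure[where A = "UNIV"] integrable_powr_pmf) auto
  finally show ?thesis by (simp add: tilted_mass_def)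
qed

text \<open>
  The exponent \<open>\<rho>\<close> enters because a probability is at most its \<open>\<rho>\<close>-th power, applied here
  conditionally on the sent word \<open>x\<close> and the received word \<open>y\<close>, where \<open>v = W(y|x)\<close>.
\<close>

lemma prob_confusion_le:
  assumes "finite A" "card A \<le> M" "l \<ge> 1" "v > 0" "s \<ge> 0" and \<rho>: "0 \<le> \<rho>" "\<rho> \<le> 1"
  shows "measure_pmf.prob (Pi_pmf A d (\<lambda>_. Q))
             {f. \<exists>S\<subseteq>A. card S = l \<and> f ` S \<subseteq> {x. v \<le> pmf (V x) y}}
           \<le> real M powr (real l * \<rho>) * (tilted_mass V Q s y / v powr s) powr (real l * \<rho>)"
proof -
  let ?e = "measure_pmf.prob (Pi_pmf A d (\<lambda>_. Q))
             {f. \<exists>S\<subseteq>A. card S = l \<and> f ` S \<subseteq> {x. v \<le> pmf (V x) y}}"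
  let ?t = "tilted_mass V Q s y / v powr s"
  have t: "0 \<le> ?t" using tilted_mass_nonneg[of V Q s y] by simp
  have "?e \<le> ?e powr \<rho>"
    using \<rho> powr_mono'[of \<rho> 1 ?e] by simp
  also have "?e powr \<rho> \<le> ((real M * ?t) ^ l) powr \<rho>"
  proof -
    have "?e \<le> (real (card A) * measure_pmf.prob Q {x. v \<le> pmf (V x) y}) ^ l"
      by (rule prob_many_hits_le[OF assms(1)])
    also have "\<dots> \<le> (real M * ?t) ^ l"
      using assms(2) t prob_likelihood_ge_le[OF assms(5,4), of Q V y]
      by (intro power_mono mult_mono) simp_all
    finally show ?thesis
      using \<rho> by (intro powr_mono2) auto
  qed
  also have "\<dots> = (real M * ?t) powr (real l * \<rho>)"
  proof (cases "real M * ?t = 0")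
    case False
    moreover have "real M * ?t \<ge> 0" by (rule mult_nonneg_nonneg[OF of_nat_0_le_iff t])
    ultimately have "real M * ?t > 0" by linarith
    then have "(real M * ?t) ^ l = (real M * ?t) powr real l" by (rule powr_realpow[symmetric])
    then show ?thesis by (simp only: powr_powr)
  qed (use assms(3) in \<open>auto simp: zero_power\<close>)
  also have "\<dots> = real M powr (real l * \<rho>) * ?t powr (real l * \<rho>)"
    by (rule powr_mult)
  finally show ?thesis .
qed

section \<open>Averaging over the random codebook\<close>

lemma ex_le_nn_integral_pmf:
  fixes h :: "'a \<Rightarrow> ennreal"
  assumes "(\<integral>\<^sup>+x. h x \<partial>measure_pmf p) \<le> b" "b < top"
  shows "\<exists>x\<in>set_pmf p. h x \<le> b"
proof (rule ccontr)
  assume "\<not> ?thesis"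
  then have gt: "h x > b" if "x \<in> set_pmf p" for x using that by auto
  have "(\<integral>\<^sup>+x. (h x - b) + b \<partial>measure_pmf p) = (\<integral>\<^sup>+x. h x \<partial>measure_pmf p)"
    using gt by (intro nn_integral_cong_AE AE_pmfI) (simp add: diff_add_cancel_ennreal less_imp_le)
  also have "\<dots> \<le> b" by fact
  finally have "(\<integral>\<^sup>+x. h x - b \<partial>measure_pmf p) + b \<le> 0 + b"
    by (simp add: nn_integral_add)
  then have "(\<integral>\<^sup>+x. h x - b \<partial>measure_pmf p) = 0"
    using assms(2) by (auto simp: ennreal_add_left_cancel_le add.commute[of _ b])
  then have "AE x in measure_pmf p. h x - b = 0" by (subst (asm) nn_integral_0_iff_AE) auto
  then have "\<forall>x\<in>set_pmf p. h x - b = 0" by (simp add: AE_measure_pmf_iff)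
  moreover obtain x where "x \<in> set_pmf p" by (meson ex_in_conv set_pmf_not_empty)
  ultimately show False using gt[of x] assms(2) by (auto simp: diff_eq_0_iff_ennreal)
qed

text \<open>
  The two exchange rules below hold on arbitrary types because a probability mass function has
  countable support. The type of the words can be uncountable when the type of the letters is countable.
\<close>

lemma nn_integral_pmf_commute:
  "(\<integral>\<^sup>+x. \<integral>\<^sup>+y. g x y \<partial>measure_pmf q \<partial>measure_pmf p)
     = (\<integral>\<^sup>+y. \<integral>\<^sup>+x. g x y \<partial>measure_pmf p \<partial>measure_pmf q)"
  using arg_cong[OF bind_commute_pmf[of p q "\<lambda>x y. return_pmf (x, y)"],
      of "\<lambda>r. \<integral>\<^sup>+z. case_prod g z \<partial>measure_pmf r"]
  by simp

lemma nn_integral_pmf_count_space_commute: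
  "(\<integral>\<^sup>+x. \<integral>\<^sup>+y. h x y \<partial>count_space UNIV \<partial>measure_pmf p)
     = (\<integral>\<^sup>+y. \<integral>\<^sup>+x. h x y \<partial>measure_pmf p \<partial>count_space UNIV)"
  using nn_integral_fst_count_space[of "\<lambda>(x, y). ennreal (pmf p x) * h x y"]
    nn_integral_snd_count_space[of "\<lambda>(x, y). ennreal (pmf p x) * h x y"]
  by (simp add: nn_integral_measure_pmf nn_integral_cmult)

text \<open>
  The sent codeword \<open>x\<close> is separated from the other codewords \<open>f\<close>, so that for given \<open>x\<close>
  and \<open>y\<close> only \<open>f\<close> is random. With \<open>t = l \<rho>\<close>, weighting by the probability
  \<open>V(y|x)\<close> turns the factor \<open>V(y|x)^(- s t)\<close> into \<open>V(y|x)^(1 - s t)\<close>. The choice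
  \<open>s = 1 / (1 + t)\<close> is the one with \<open>1 - s t = s\<close>, so averaging over \<open>x\<close> gives one more
  factor \<open>T(y)\<close>.
\<close>

lemma random_codeword_error_le:
  fixes V :: "'a \<Rightarrow> 'b pmf" and \<rho> :: real
  assumes i: "i \<in> {1..M}" and l: "1 \<le> l" "l \<le> M" and \<rho>: "0 \<le> \<rho>" "\<rho> \<le> 1"
  shows "(\<integral>\<^sup>+X. emeasure (measure_pmf (V (X i))) {y. i \<notin> top_list l M (\<lambda>j. pmf (V (X j)) y)}
            \<partial>Pi_pmf {1..M} d (\<lambda>_. Q))
         \<le> ennreal (real M powr (real l * \<rho>)) *
           (\<integral>\<^sup>+y. ennreal (tilted_mass V Q (1 / (1 + real l * \<rho>)) y powr (1 + real l * \<rho>))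
              \<partial>count_space UNIV)"
proof -
  define t where "t = real l * \<rho>"
  define s where "s = 1 / (1 + t)"
  define A where "A = {1..M} - {i}"
  define K where "K = real M powr t"
  define T where "T = tilted_mass V Q s"
  let ?p = "Pi_pmf A d (\<lambda>_. Q)"
  define E where "E = (\<lambda>x y. {f. i \<notin> top_list l M (\<lambda>j. pmf (V ((f(i := x)) j)) y)})"
  have t: "t \<ge> 0" using \<rho> by (simp add: t_def)
  have s: "s > 0" "1 - s * t = s" using t by (auto simp: s_def field_simps)
  have T: "T y \<ge> 0" for y by (simp add: T_def tilted_mass_nonneg)
  have A: "finite A" "card A \<le> M" "{1..M} = insert i A" "i \<notin> A"
    using i by (auto simp: A_def)
  have confusion: "emeasure (measure_pmf ?p) (E x y) \<le> ennreal (K * (T y / pmf (V x) y powr s) powr t)"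
    if "y \<in> set_pmf (V x)" for x y
  proof -
    have "E x y \<subseteq> {f. \<exists>S\<subseteq>A. card S = l \<and> f ` S \<subseteq> {x'. pmf (V x) y \<le> pmf (V x') y}}"
    proof
      fix f assume f: "f \<in> E x y"
      let ?D = "top_list l M (\<lambda>j. pmf (V ((f(i := x)) j)) y)"
      have nD: "i \<notin> ?D" using f by (simp add: E_def)
      have "?D \<subseteq> A" using top_list_subset[OF l(2)] nD by (auto simp: A_def)
      moreover have "f ` ?D \<subseteq> {x'. pmf (V x) y \<le> pmf (V x') y}"
      proof clarify
        fix j assume j: "j \<in> ?D"
        then have "j \<noteq> i" using nD by blast
        with top_list_max[OF l(2) j i nD] show "pmf (V x) y \<le> pmf (V (f j)) y" by simp
      qed
      ultimately show "f \<in> {f. \<exists>S\<subseteq>A. card S = l \<and> f ` S \<subseteq> {x'. pmf (V x) y \<le> pmf (V x') y}}"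
        using card_top_list[OF l(2)] by blast
    qed
    then have "measure_pmf.prob ?p (E x y) \<le> K * (T y / pmf (V x) y powr s) powr t"
      unfolding K_def T_def t_def
      by (intro order_trans[OF measure_pmf.finite_measure_mono prob_confusion_le])
        (use A l \<rho> s that in \<open>auto simp: pmf_positive\<close>)
    then show ?thesis by (simp add: measure_pmf.emeasure_eq_measure ennreal_leI)
  qed
  have weight: "pmf (V x) y * (K * (T y / pmf (V x) y powr s) powr t)
      = K * T y powr t * pmf (V x) y powr s" for x y
  proof (cases "pmf (V x) y = 0")
    case False
    then have v: "pmf (V x) y > 0" by (simp add: pmf_positive set_pmf_iff)
    have "pmf (V x) y powr s = pmf (V x) y powr (1 - s * t)" by (simp only: s)
    also have "\<dots> = pmf (V x) y / pmf (V x) y powr (s * t)"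
      using v by (simp add: powr_diff)
    finally have vs: "pmf (V x) y powr s = pmf (V x) y / pmf (V x) y powr (s * t)" .
    have "(T y / pmf (V x) y powr s) powr t = T y powr t / pmf (V x) y powr (s * t)"
      using T by (simp add: powr_divide powr_powr)
    then show ?thesis by (simp add: vs)
  qed simp
  have "(\<integral>\<^sup>+X. emeasure (measure_pmf (V (X i))) {y. i \<notin> top_list l M (\<lambda>j. pmf (V (X j)) y)}
            \<partial>Pi_pmf {1..M} d (\<lambda>_. Q))
      = (\<integral>\<^sup>+x. \<integral>\<^sup>+f. emeasure (measure_pmf (V x)) {y. f \<in> E x y} \<partial>?p \<partial>Q)"
    unfolding A(3) Pi_pmf_insert'[OF A(1,4)] by (simp add: E_def)
  also have "\<dots> = (\<integral>\<^sup>+x. \<integral>\<^sup>+f. \<integral>\<^sup>+y. indicator (E x y) f \<partial>V x \<partial>?p \<partial>Q)"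
    by (intro nn_integral_cong)
      (simp add: nn_integral_indicator[symmetric] indicator_def del: nn_integral_indicator)
  also have "\<dots> = (\<integral>\<^sup>+x. \<integral>\<^sup>+y. emeasure (measure_pmf ?p) (E x y) \<partial>V x \<partial>Q)"
    by (subst nn_integral_pmf_commute) simp
  also have "\<dots> \<le> (\<integral>\<^sup>+x. \<integral>\<^sup>+y. ennreal (K * (T y / pmf (V x) y powr s) powr t) \<partial>V x \<partial>Q)"
    by (intro nn_integral_mono nn_integral_mono_AE AE_pmfI confusion)
  also have "\<dots> = (\<integral>\<^sup>+x. \<integral>\<^sup>+y. ennreal (K * T y powr t * pmf (V x) y powr s) \<partial>count_space UNIV \<partial>Q)"
    by (simp add: nn_integral_measure_pmf[of "V _"] ennreal_mult'[symmetric] weight)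
  also have "\<dots> = (\<integral>\<^sup>+y. \<integral>\<^sup>+x. ennreal (K * T y powr t * pmf (V x) y powr s) \<partial>Q \<partial>count_space UNIV)"
    by (rule nn_integral_pmf_count_space_commute)
  also have "\<dots> = (\<integral>\<^sup>+y. ennreal (K * T y powr (1 + t)) \<partial>count_space UNIV)"
  proof (intro nn_integral_cong)
    fix y
    have "(\<integral>\<^sup>+x. ennreal (K * T y powr t * pmf (V x) y powr s) \<partial>Q)
        = ennreal (\<integral>x. K * T y powr t * pmf (V x) y powr s \<partial>Q)"
      using s by (intro nn_integral_eq_integral integrable_mult_right integrable_powr_pmf)
        (auto simp: K_def)
    also have "(\<integral>x. K * T y powr t * pmf (V x) y powr s \<partial>Q) = K * T y powr t * T y"
      by (simp add: T_def tilted_mass_def)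
    also have "\<dots> = K * T y powr (1 + t)"
      using T[of y] by (cases "T y = 0") (auto simp: powr_add)
    finally show "(\<integral>\<^sup>+x. ennreal (K * T y powr t * pmf (V x) y powr s) \<partial>Q)
        = ennreal (K * T y powr (1 + t))" .
  qed
  also have "\<dots> = ennreal K * (\<integral>\<^sup>+y. ennreal (T y powr (1 + t)) \<partial>count_space UNIV)"
    by (simp add: ennreal_mult' K_def nn_integral_cmult)
  finally show ?thesis by (simp add: K_def T_def s_def t_def)
qed

text \<open>
  The bound on the expected error is the same for every index, so it bounds the average error of
  the random codebook, and hence that of some codebook in its support.
\<close>

lemma ex_codebook_sum_error_le:
  fixes V :: "'a \<Rightarrow> 'b pmf" and \<rho> :: real
  assumes l: "1 \<le> l" "l \<le> M" and \<rho>: "0 \<le> \<rho>" "\<rho> \<le> 1" and "B \<ge> 0"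
    and B: "(\<integral>\<^sup>+y. ennreal (tilted_mass V Q (1 / (1 + real l * \<rho>)) y powr (1 + real l * \<rho>))
              \<partial>count_space UNIV) \<le> ennreal B"
  shows "\<exists>X. (\<forall>i\<in>{1..M}. X i \<in> set_pmf Q) \<and>
           (\<Sum>i = 1..M. measure_pmf.prob (V (X i)) {y. i \<notin> top_list l M (\<lambda>j. pmf (V (X j)) y)})
             \<le> real M * (real M powr (real l * \<rho>) * B)"
proof -
  let ?err = "\<lambda>X i. {y. i \<notin> top_list l M (\<lambda>j. pmf (V (X j)) y)}"
  let ?b = "real M powr (real l * \<rho>) * B"
  let ?C = "Pi_pmf {1..M} undefined (\<lambda>_. Q)"
  have "(\<integral>\<^sup>+X. (\<Sum>i = 1..M. emeasure (measure_pmf (V (X i))) (?err X i)) \<partial>?C)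
      = (\<Sum>i = 1..M. \<integral>\<^sup>+X. emeasure (measure_pmf (V (X i))) (?err X i) \<partial>?C)"
    by (rule nn_integral_sum) simp
  also have "\<dots> \<le> (\<Sum>i = 1..M. ennreal ?b)"
  proof (intro sum_mono)
    fix i assume "i \<in> {1..M}"
    from order_trans[OF random_codeword_error_le[OF this l \<rho>] mult_left_mono[OF B]]
    show "(\<integral>\<^sup>+X. emeasure (measure_pmf (V (X i))) (?err X i) \<partial>?C) \<le> ennreal ?b"
      using \<open>B \<ge> 0\<close> by (simp add: ennreal_mult)
  qed
  also have "\<dots> = ennreal (real M * ?b)"
    using \<open>B \<ge> 0\<close> by (simp add: ennreal_of_nat_eq_real_of_nat ennreal_mult'[symmetric])
  finally obtain X where X: "X \<in> set_pmf ?C"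
    and le: "(\<Sum>i = 1..M. emeasure (measure_pmf (V (X i))) (?err X i)) \<le> ennreal (real M * ?b)"
    using ex_le_nn_integral_pmf[of ?C _ "ennreal (real M * ?b)"] by auto
  have "(\<Sum>i = 1..M. measure_pmf.prob (V (X i)) (?err X i)) \<le> real M * ?b"
    using le \<open>B \<ge> 0\<close> by (simp add: measure_pmf.emeasure_eq_measure sum_ennreal)
  moreover have "X i \<in> set_pmf Q" if "i \<in> {1..M}" for i
    using X that set_Pi_pmf[of "{1..M}" undefined "\<lambda>_. Q"] by (auto simp: PiE_dflt_def)
  ultimately show ?thesis by blast
qed

section \<open>Memoryless channels\<close>

lemma tilted_mass_words:
  assumes "s \<ge> 0" "y \<in> words n"
  shows "tilted_mass (channel_output W n) (Pi_pmf {1..n} undefined (\<lambda>_. P)) s y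
           = (\<Prod>j = 1..n. tilted_mass W P s (y j))"
proof -
  have "tilted_mass (channel_output W n) (Pi_pmf {1..n} undefined (\<lambda>_. P)) s y
      = measure_pmf.expectation (Pi_pmf {1..n} undefined (\<lambda>_. P))
          (\<lambda>x. \<Prod>j = 1..n. pmf (W (x j)) (y j) powr s)"
    using assms(2) by (simp add: tilted_mass_def pmf_channel_output prod_powr_distrib)
  also have "\<dots> = (\<Prod>j = 1..n. tilted_mass W P s (y j))"
    unfolding tilted_mass_def
    by (rule expectation_prod_Pi_pmf[where f = "\<lambda>j a. pmf (W a) (y j) powr s"])
      (use assms(1) in \<open>auto intro: integrable_powr_pmf\<close>)
  finally show ?thesis .
qed

lemma tilted_mass_outside_words:
  assumes "y \<notin> words n"
  shows "tilted_mass (channel_output W n) Q s y = 0"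
proof -
  have "pmf (channel_output W n x) y = 0" for x
    using assms set_pmf_channel_output[of W n x] by (auto simp: set_pmf_iff)
  then show ?thesis by (simp add: tilted_mass_def)
qed

text \<open>
  To sum the product over all words without an induction on \<open>n\<close>, the one-letter summand is
  normalised to a probability mass function \<open>g\<close>. The summand at a word is then \<open>G ^ n\<close> times the
  probability of that word under the \<open>n\<close>-fold product of \<open>g\<close>.
\<close>

lemma nn_integral_tilted_mass_product_le:
  assumes "s \<ge> 0" "G > 0"
    and G: "(\<integral>\<^sup>+y. ennreal (tilted_mass W P s y powr r) \<partial>count_space UNIV) = ennreal G"
  shows "(\<integral>\<^sup>+y. ennreal (tilted_mass (channel_output W n) (Pi_pmf {1..n} undefined (\<lambda>_. P)) s y powr r)
            \<partial>count_space UNIV) \<le> ennreal (G ^ n)"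
proof -
  define g where "g = (\<lambda>y. tilted_mass W P s y powr r / G)"
  have g_nonneg: "g y \<ge> 0" for y using assms(2) by (simp add: g_def)
  have "(\<integral>\<^sup>+y. ennreal (g y) \<partial>count_space UNIV) = ennreal G / ennreal G"
    using assms(2) by (simp add: g_def divide_ennreal[symmetric] nn_integral_divide G)
  also have "\<dots> = 1" using assms(2) by (simp add: divide_ennreal)
  finally have pmf_g: "pmf (embed_pmf g) y = g y" for y
    by (intro pmf_embed_pmf g_nonneg)
  let ?Q = "Pi_pmf {1..n} undefined (\<lambda>_. embed_pmf g)"
  have "tilted_mass (channel_output W n) (Pi_pmf {1..n} undefined (\<lambda>_. P)) s y powr r
      \<le> G ^ n * pmf ?Q y" for y
  proof (cases "y \<in> words n")
    case True
    then have "pmf ?Q y = (\<Prod>j = 1..n. g (y j))"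
      by (subst pmf_Pi') (auto simp: words_def PiE_def extensional_def pmf_g)
    also have "\<dots> = (\<Prod>j = 1..n. tilted_mass W P s (y j) powr r) / G ^ n"
      by (simp add: g_def prod_dividef)
    finally show ?thesis
      using assms(2) unfolding tilted_mass_words[OF assms(1) True] prod_powr_distrib by simp
  qed (use assms(2) in \<open>simp add: tilted_mass_outside_words\<close>)
  then have "(\<integral>\<^sup>+y. ennreal (tilted_mass (channel_output W n) (Pi_pmf {1..n} undefined (\<lambda>_. P)) s y powr r)
            \<partial>count_space UNIV) \<le> (\<integral>\<^sup>+y. ennreal (G ^ n * pmf ?Q y) \<partial>count_space UNIV)"
    by (intro nn_integral_mono ennreal_leI)
  also have "\<dots> = ennreal (G ^ n) * (\<integral>\<^sup>+y. ennreal (pmf ?Q y) \<partial>count_space UNIV)"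
    using assms(2) by (simp add: ennreal_mult nn_integral_cmult)
  also have "\<dots> = ennreal (G ^ n)" by (simp add: nn_integral_pmf)
  finally show ?thesis .
qed

lemma tilted_mass_infsum:
  assumes "s \<ge> 0"
  shows "tilted_mass V Q s y = (\<Sum>\<^sub>\<infinity>x\<in>UNIV. pmf Q x * pmf (V x) y powr s)"
proof -
  have "Infinite_Set_Sum.abs_summable_on (\<lambda>x. pmf Q x * pmf (V x) y powr s) UNIV"
    using E0_inner_summable[OF assms, of Q V y]
    by (simp add: abs_summable_equivalent[symmetric] summable_on_iff_abs_summable_on_real[symmetric])
  then show ?thesis
    by (simp add: tilted_mass_def pmf_expectation_eq_infsetsum infsetsum_infsum)
qed

lemma nn_integral_tilted_mass_E0:
  assumes "t \<ge> 0"
  shows "(\<integral>\<^sup>+y. ennreal (tilted_mass W P (1 / (1 + t)) y powr (1 + t)) \<partial>count_space UNIV)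
           = ennreal (2 powr - E0 W t P)"
proof -
  let ?g = "\<lambda>y. tilted_mass W P (1 / (1 + t)) y powr (1 + t)"
  have g: "?g = (\<lambda>y. (\<Sum>\<^sub>\<infinity>x\<in>UNIV. pmf P x * pmf (W x) y powr (1 / (1 + t))) powr (1 + t))"
    using assms by (simp add: tilted_mass_infsum)
  have "Infinite_Set_Sum.abs_summable_on ?g UNIV"
    using E0_outer_summable[OF assms, of P W] unfolding g
    by (simp add: abs_summable_equivalent[symmetric] summable_on_iff_abs_summable_on_real[symmetric])
  then have "(\<integral>\<^sup>+y. ennreal (?g y) \<partial>count_space UNIV) = ennreal (infsum ?g UNIV)"
    by (simp add: nn_integral_conv_infsetsum infsetsum_infsum)
  also have "infsum ?g UNIV = 2 powr - E0 W t P"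
    using E0_argument_bounds[OF assms, of P W] unfolding g E0_def by simp
  finally show ?thesis .
qed

section \<open>The exponent of the codes\<close>

text \<open>
  Adding \<open>l\<close> to the number of codewords that the rate requires leaves room for a list of \<open>l\<close>
  indices at every blocklength. This costs at most a factor \<open>l + 2\<close> in the number of codewords,
  hence \<open>(l + 2)^(l \<rho>)\<close> in the error bound, which is replaced by its value at \<open>\<rho> = 1\<close> to be
  uniform in \<open>\<rho>\<close>.
\<close>

lemma ex_list_code_avg_err_le:
  fixes W :: "'x::countable \<Rightarrow> 'y::countable pmf"
  assumes n: "n \<ge> 1" and l: "l \<ge> 1" and R: "R \<ge> 0" and \<rho>: "0 \<le> \<rho>" "\<rho> \<le> 1"
  shows "\<exists>c. is_list_code n l c \<and> code_rate n c \<ge> R \<and>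
           avg_err_prob W n c
             \<le> real (l + 2) ^ l * 2 powr (- real n * (- real l * \<rho> * R + E0 W (real l * \<rho>) P))"
proof -
  define t where "t = real l * \<rho>"
  define N where "N = 2 powr (real n * R)"
  define M where "M = nat \<lceil>N\<rceil> + l"
  define G where "G = 2 powr - E0 W t P"
  have t: "0 \<le> t" "t \<le> real l" using \<rho> by (auto simp: t_def intro: mult_left_le)
  have N: "N \<ge> 1" using R by (simp add: N_def ge_one_powr_ge_zero)
  have M: "N \<le> real M" "l \<le> M" "1 \<le> M" using l by (auto simp: M_def) linarith
  have "real M \<le> N + 1 + real l" using N unfolding M_def by linarith
  also have "\<dots> \<le> real (l + 2) * N"
    using N mult_left_mono[of 1 N "real (l + 1)"] by (simp add: algebra_simps)
  finally have M_le: "real M \<le> real (l + 2) * N" .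
  let ?V = "channel_output W n" and ?Q = "Pi_pmf {1..n} undefined (\<lambda>_. P)"
  have "(\<integral>\<^sup>+y. ennreal (tilted_mass ?V ?Q (1 / (1 + t)) y powr (1 + t)) \<partial>count_space UNIV)
      \<le> ennreal (G ^ n)"
    unfolding G_def using t nn_integral_tilted_mass_E0[OF t(1), of W P]
    by (intro nn_integral_tilted_mass_product_le) auto
  moreover have "0 \<le> G ^ n" by (simp add: G_def)
  ultimately obtain X where X: "\<And>i. i \<in> {1..M} \<Longrightarrow> X i \<in> set_pmf ?Q"
    and err: "(\<Sum>i = 1..M. measure_pmf.prob (?V (X i)) {y. i \<notin> top_list l M (\<lambda>j. pmf (?V (X j)) y)})
             \<le> real M * (real M powr t * G ^ n)"
    using ex_codebook_sum_error_le[OF l M(2) \<rho>, of "G ^ n" ?V ?Q] unfolding t_def by blast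
  define c where "c = \<lparr>code_size = M, codeword = X,
    decoder = (\<lambda>y. top_list l M (\<lambda>j. pmf (?V (X j)) y))\<rparr>"
  have "set_pmf ?Q \<subseteq> words n"
    using set_Pi_pmf_subset[of "{1..n}" undefined "\<lambda>_. P"]
    by (auto simp: words_def PiE_def extensional_def)
  then have "is_list_code n l c"
    using X M l top_list_subset[OF M(2)] card_top_list[OF M(2)]
    by (auto simp: is_list_code_def c_def)
  moreover have "code_rate n c \<ge> R"
  proof -
    have "real n * R = log 2 N" by (simp add: N_def)
    also have "\<dots> \<le> log 2 (real M)" using M N by (intro log_mono) auto
    finally show ?thesis using n by (simp add: code_rate_def c_def field_simps)
  qed
  moreover have "avg_err_prob W n c
      \<le> real (l + 2) ^ l * 2 powr (- real n * (- real l * \<rho> * R + E0 W (real l * \<rho>) P))"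
  proof -
    have "(\<Sum>i = 1..M. err_prob W n c i) \<le> real M * (real M powr t * G ^ n)"
    proof (rule order_trans[OF sum_mono err])
      show "err_prob W n c i
          \<le> measure_pmf.prob (?V (X i)) {y. i \<notin> top_list l M (\<lambda>j. pmf (?V (X j)) y)}" for i
        by (auto simp: err_prob_def c_def intro!: measure_pmf.finite_measure_mono)
    qed
    then have "avg_err_prob W n c \<le> real M powr t * G ^ n"
      using M by (simp add: avg_err_prob_def c_def field_simps)
    also have "\<dots> \<le> (real (l + 2) * N) powr t * G ^ n"
      using t M_le by (intro mult_right_mono powr_mono2) (auto simp: G_def)
    also have "\<dots> = real (l + 2) powr t * (N powr t * G ^ n)"
      by (simp only: powr_mult mult.assoc)
    also have "\<dots> \<le> real (l + 2) ^ l * (N powr t * G ^ n)"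
    proof (rule mult_right_mono)
      have "real (l + 2) powr t \<le> real (l + 2) powr real l"
        using t by (intro powr_mono) auto
      then show "real (l + 2) powr t \<le> real (l + 2) ^ l"
        by (subst (asm) powr_realpow) auto
    qed (simp add: G_def)
    also have "G ^ n = 2 powr (- E0 W t P * real n)"
      unfolding G_def by (subst powr_realpow[symmetric]) (auto simp: powr_powr)
    also have "N powr t * \<dots> = 2 powr (- real n * (- real l * \<rho> * R + E0 W (real l * \<rho>) P))"
      by (simp add: N_def powr_powr powr_add[symmetric] t_def algebra_simps)
    finally show ?thesis .
  qed
  ultimately show ?thesis by blast
qed

lemma exponent_ge:
  assumes "n \<ge> 1" "K > 0" "p \<ge> 0" "p \<le> K * 2 powr (- real n * F)"
  shows "exponent n p \<ge> ereal (F - log 2 K / real n)"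
proof (cases "p = 0")
  case False
  then have "log 2 p \<le> log 2 (K * 2 powr (- real n * F))"
    using assms by (intro log_mono) auto
  also have "\<dots> = log 2 K - real n * F"
    using assms(2) by (subst log_mult) auto
  finally have "real n * F - log 2 K \<le> - log 2 p" by simp
  then have "(real n * F - log 2 K) / real n \<le> - log 2 p / real n"
    by (rule divide_right_mono) simp
  then show ?thesis
    using False assms(1) by (simp add: exponent_def diff_divide_distrib)
qed (simp add: exponent_def)

lemma avg_err_prob_nonneg: "avg_err_prob W n c \<ge> 0"
  by (simp add: avg_err_prob_def err_prob_def sum_nonneg)

theorem mainTheorem8:
  fixes W :: "'x::countable \<Rightarrow> 'y::countable pmf" and L :: nat and R :: real
  assumes "L \<ge> 2" and "R \<ge> 0"
  shows "\<exists>C :: nat \<Rightarrow> ('x, 'y) list_code.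
           (\<forall>n\<ge>1. is_list_code n (L - 1) (C n) \<and> code_rate n (C n) \<ge> R) \<and>
           liminf (\<lambda>n. exponent n (avg_err_prob W n (C n))) \<ge> random_coding_exponent W (L - 1) R"
proof -
  define l where "l = L - 1"
  have l: "l \<ge> 1" using assms(1) by (simp add: l_def)
  define F where "F = (\<lambda>\<rho> P. - real l * \<rho> * R + E0 W (real l * \<rho>) P)"
  let ?E = "random_coding_exponent W l R"
  have E: "?E = (SUP P\<in>UNIV. SUP \<rho>\<in>{0..1}. ereal (F \<rho> P))"
    by (simp add: random_coding_exponent_def F_def)
  \<comment> \<open>Any finite lower bound on the supremum will do: approximation from below needs a smaller element.\<close>
  have "ereal (F 0 undefined) \<le> ?E"
    unfolding E by (intro SUP_upper2[of undefined] SUP_upper2[of 0]) auto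
  then have E_gt: "- \<infinity> < ?E" by (rule less_le_trans[rotated]) simp
  then obtain u where u: "\<And>n. u n < ?E" "u \<longlonglongrightarrow> ?E"
    using approx_from_below_dense_linorder[OF E_gt] by blast
  have "\<exists>P \<rho>. 0 \<le> \<rho> \<and> \<rho> \<le> 1 \<and> u n < ereal (F \<rho> P)" for n
    using u(1)[of n] unfolding E less_SUP_iff by (meson atLeastAtMost_iff)
  then obtain P \<rho> where P\<rho>: "\<And>n. 0 \<le> \<rho> n" "\<And>n. \<rho> n \<le> 1" "\<And>n. u n < ereal (F (\<rho> n) (P n))"
    by metis
  \<comment> \<open>The code of blocklength \<open>n\<close> is built from the \<open>n\<close>-th approximating pair.\<close>
  have "\<exists>c. n \<ge> 1 \<longrightarrow> is_list_code n l c \<and> code_rate n c \<ge> R \<and>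
           avg_err_prob W n c \<le> real (l + 2) ^ l * 2 powr (- real n * F (\<rho> n) (P n))" for n
    using ex_list_code_avg_err_le[of n l R "\<rho> n" W "P n"] l assms(2) P\<rho>(1,2) unfolding F_def by blast
  then obtain C where C: "\<And>n. n \<ge> 1 \<Longrightarrow> is_list_code n l (C n)" "\<And>n. n \<ge> 1 \<Longrightarrow> code_rate n (C n) \<ge> R"
    "\<And>n. n \<ge> 1 \<Longrightarrow> avg_err_prob W n (C n) \<le> real (l + 2) ^ l * 2 powr (- real n * F (\<rho> n) (P n))"
    by metis
  define k where "k = log 2 (real (l + 2) ^ l)"
  have "u n + ereal (- k / real n) \<le> exponent n (avg_err_prob W n (C n))" if "n \<ge> 1" for n
  proof -
    have "u n + ereal (- k / real n) \<le> ereal (F (\<rho> n) (P n)) + ereal (- k / real n)"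
      using P\<rho>(3)[of n] by (intro add_right_mono) simp
    also have "\<dots> = ereal (F (\<rho> n) (P n) - k / real n)" by simp
    also have "\<dots> \<le> exponent n (avg_err_prob W n (C n))"
      unfolding k_def by (intro exponent_ge that C avg_err_prob_nonneg) auto
    finally show ?thesis .
  qed
  then have ev: "\<forall>\<^sub>F n in sequentially. u n + ereal (- k / real n) \<le> exponent n (avg_err_prob W n (C n))"
    by (intro eventually_sequentiallyI)
  have "(\<lambda>n. - k / real n) \<longlonglongrightarrow> 0" by (rule lim_const_over_n)
  then have "(\<lambda>n. ereal (- k / real n)) \<longlonglongrightarrow> ereal 0" by (rule tendsto_ereal)
  then have "(\<lambda>n. u n + ereal (- k / real n)) \<longlonglongrightarrow> ?E + ereal 0"
    by (intro tendsto_add_ereal_general1 u(2)) auto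
  then have "liminf (\<lambda>n. u n + ereal (- k / real n)) = ?E"
    by (simp add: lim_imp_Liminf)
  with Liminf_mono[OF ev] have "?E \<le> liminf (\<lambda>n. exponent n (avg_err_prob W n (C n)))" by simp
  with C(1,2) show ?thesis unfolding l_def by blast
qed

end
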